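(* A $\kappa$-frame $L$ is clear if and only if there is a Boolean frame (complete Boolean algebra) $B$ such that $L$ is isomorphic to a sub-$\kappa$-frame of $B$ which generates $B$ under arbitrary joins (i.e. every element of $B$ is a join of elements of the sub-$\kappa$-frame).
   Context: Here $\kappa$ is either an infinite regular cardinal or the symbol $\infty$. A $\kappa$-set is a set of cardinality less than $\kappa$ (any set if $\kappa=\infty$). A $\kappa$-frame is a bounded distributive lattice with joins of all $\kappa$-sets, over which binary meets distribute; for $\kappa=\infty$ this is a frame. Homomorphisms preserve finite meets and $\kappa$-joins (joins of $\kappa$-sets); a sub-$\kappa$-frame is a subset closed under finite meets and $\kappa$-joins (in particular containing $0$ and $1$). A congruence on $L$ is an equivalence relation on $L$ that is a sub-$\kappa$-frame of $L\times L$; congruences are ordered by inclusion. A congruence $C$ is dense if $(0,a)\in C$ implies $a=0$. Every $\kappa$-frame $L$ has a largest dense congruence, $\mathfrak{D}_L=\{(a,b)\mid \forall x\in L:\ a\wedge x=0\iff b\wedge x=0\}$. A $\kappa$-frame $L$ is called clear if $\mathfrak{D}_L$ is the equality relation on $L$. *)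

theory Defs
  imports "HOL-Algebra.Complete_Lattice"
begin

unbundle cardinal_syntax

text \<open>The parameter \<open>\<kappa>\<close>: a cardinal, given as in the library by a cardinal order on a type
  \<open>'k\<close>, or the symbol \<open>\<infinity>\<close>, written \<open>Unbounded\<close>.\<close>

datatype 'k kappa = Regular "'k rel" | Unbounded

fun admissible :: "'k kappa \<Rightarrow> bool" where
  "admissible (Regular r) \<longleftrightarrow> Cinfinite r \<and> regularCard r"
| "admissible Unbounded \<longleftrightarrow> True"

fun kappa_set :: "'k kappa \<Rightarrow> 'a set \<Rightarrow> bool" where
  "kappa_set (Regular r) A \<longleftrightarrow> |A| <o r"
| "kappa_set Unbounded A \<longleftrightarrow> True"

locale kappa_frame = bounded_lattice L
  for \<kappa> :: "'k kappa" and L :: "('a, 'm) gorder_scheme" (structure) +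
  assumes meet_join_distrib:
      "\<lbrakk>x \<in> carrier L; y \<in> carrier L; z \<in> carrier L\<rbrakk> \<Longrightarrow>
         x \<sqinter> (y \<squnion> z) = (x \<sqinter> y) \<squnion> (x \<sqinter> z)"
    and kappa_sup_exists:
      "\<lbrakk>A \<subseteq> carrier L; kappa_set \<kappa> A\<rbrakk> \<Longrightarrow> \<exists>s. is_lub L s A"
    and meet_kappa_sup_distrib:
      "\<lbrakk>x \<in> carrier L; A \<subseteq> carrier L; kappa_set \<kappa> A\<rbrakk> \<Longrightarrow>
         x \<sqinter> (\<Squnion>A) = \<Squnion>((\<lambda>a. x \<sqinter> a) ` A)"

text \<open>A frame is an \<open>\<infinity>\<close>-frame. The parameter type of \<open>Unbounded\<close> is irrelevant and is set
  to \<open>unit\<close>.\<close>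

locale boolean_frame = kappa_frame "Unbounded :: unit kappa" B
  for B :: "('a, 'm) gorder_scheme" (structure) +
  assumes complement_exists:
    "x \<in> carrier B \<Longrightarrow> \<exists>y\<in>carrier B. x \<sqinter> y = \<bottom> \<and> x \<squnion> y = \<top>"

definition kappa_hom ::
  "'k kappa \<Rightarrow> ('a, 'm) gorder_scheme \<Rightarrow> ('b, 'n) gorder_scheme \<Rightarrow> ('a \<Rightarrow> 'b) set" where
  "kappa_hom \<kappa> L M = {f. f ` carrier L \<subseteq> carrier M
     \<and> f \<top>\<^bsub>L\<^esub> = \<top>\<^bsub>M\<^esub>
     \<and> (\<forall>x\<in>carrier L. \<forall>y\<in>carrier L. f (x \<sqinter>\<^bsub>L\<^esub> y) = f x \<sqinter>\<^bsub>M\<^esub> f y)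
     \<and> (\<forall>A. A \<subseteq> carrier L \<and> kappa_set \<kappa> A \<longrightarrow> f (\<Squnion>\<^bsub>L\<^esub> A) = \<Squnion>\<^bsub>M\<^esub> (f ` A))}"

definition kappa_iso ::
  "'k kappa \<Rightarrow> ('a, 'm) gorder_scheme \<Rightarrow> ('b, 'n) gorder_scheme \<Rightarrow> ('a \<Rightarrow> 'b) set" where
  "kappa_iso \<kappa> L M = {f \<in> kappa_hom \<kappa> L M. bij_betw f (carrier L) (carrier M)}"

definition sub_kappa_frame ::
  "'k kappa \<Rightarrow> ('a, 'm) gorder_scheme \<Rightarrow> 'a set \<Rightarrow> bool" where
  "sub_kappa_frame \<kappa> L S \<longleftrightarrow> S \<subseteq> carrier L
     \<and> \<top>\<^bsub>L\<^esub> \<in> S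
     \<and> (\<forall>x\<in>S. \<forall>y\<in>S. x \<sqinter>\<^bsub>L\<^esub> y \<in> S)
     \<and> (\<forall>A. A \<subseteq> S \<and> kappa_set \<kappa> A \<longrightarrow> \<Squnion>\<^bsub>L\<^esub> A \<in> S)"

definition join_generates :: "('a, 'm) gorder_scheme \<Rightarrow> 'a set \<Rightarrow> bool" where
  "join_generates B S \<longleftrightarrow> (\<forall>b\<in>carrier B. \<exists>A\<subseteq>S. b = \<Squnion>\<^bsub>B\<^esub> A)"

text \<open>If \<open>B\<close> is generated under joins by a copy of \<open>L\<close>, an element of \<open>B\<close> is determined by
  the set of generators below it. So up to isomorphism every such \<open>B\<close> lives on the type
  \<open>'a set\<close>, where \<open>'a\<close> is the type of elements of \<open>L\<close>, and an existential over all \<open>B\<close>, which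
  HOL cannot take over types, may be taken over structures on that type.\<close>

definition prod_order ::
  "('a, 'm) gorder_scheme \<Rightarrow> ('b, 'n) gorder_scheme \<Rightarrow> ('a \<times> 'b) gorder" where
  "prod_order L M = \<lparr>carrier = carrier L \<times> carrier M, eq = (=),
     le = (\<lambda>p q. fst p \<sqsubseteq>\<^bsub>L\<^esub> fst q \<and> snd p \<sqsubseteq>\<^bsub>M\<^esub> snd q)\<rparr>"

definition frame_congruence :: "'k kappa \<Rightarrow> ('a, 'm) gorder_scheme \<Rightarrow> 'a rel \<Rightarrow> bool" where
  "frame_congruence \<kappa> L C \<longleftrightarrow>
     equiv (carrier L) C \<and> sub_kappa_frame \<kappa> (prod_order L L) C"

definition dense_rel :: "('a, 'm) gorder_scheme \<Rightarrow> 'a rel \<Rightarrow> bool" where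
  "dense_rel L C \<longleftrightarrow> (\<forall>a. (\<bottom>\<^bsub>L\<^esub>, a) \<in> C \<longrightarrow> a = \<bottom>\<^bsub>L\<^esub>)"

definition largest_dense :: "('a, 'm) gorder_scheme \<Rightarrow> 'a rel" (\<open>\<DD>\<index>\<close>) where
  "\<DD>\<^bsub>L\<^esub> = {(a, b). a \<in> carrier L \<and> b \<in> carrier L \<and>
     (\<forall>x\<in>carrier L. a \<sqinter>\<^bsub>L\<^esub> x = \<bottom>\<^bsub>L\<^esub> \<longleftrightarrow> b \<sqinter>\<^bsub>L\<^esub> x = \<bottom>\<^bsub>L\<^esub>)}"

definition clear :: "('a, 'm) gorder_scheme \<Rightarrow> bool" where
  "clear L \<longleftrightarrow> \<DD>\<^bsub>L\<^esub> = Id_on (carrier L)"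


subsection \<open>\<open>\<DD>\<^bsub>L\<^esub>\<close> is the largest dense congruence\<close>

lemma (in partial_order) sup_eqI: "is_lub L s A \<Longrightarrow> \<Squnion>A = s"
  unfolding sup_def by (rule some_equality) (auto intro: least_unique)

lemma (in partial_order) inf_eqI: "greatest L s (Lower L A) \<Longrightarrow> \<Sqinter>A = s"
  unfolding inf_def by (rule some_equality) (auto intro: greatest_unique)

lemma is_lub_iff:
  "A \<subseteq> carrier L \<Longrightarrow> is_lub L s A \<longleftrightarrow> s \<in> carrier L \<and> (\<forall>a\<in>A. a \<sqsubseteq>\<^bsub>L\<^esub> s)
     \<and> (\<forall>u\<in>carrier L. (\<forall>a\<in>A. a \<sqsubseteq>\<^bsub>L\<^esub> u) \<longrightarrow> s \<sqsubseteq>\<^bsub>L\<^esub> u)"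
  unfolding least_def Upper_def by blast

lemma is_glb_iff:
  "A \<subseteq> carrier L \<Longrightarrow> greatest L s (Lower L A) \<longleftrightarrow> s \<in> carrier L \<and> (\<forall>a\<in>A. s \<sqsubseteq>\<^bsub>L\<^esub> a)
     \<and> (\<forall>u\<in>carrier L. (\<forall>a\<in>A. u \<sqsubseteq>\<^bsub>L\<^esub> a) \<longrightarrow> u \<sqsubseteq>\<^bsub>L\<^esub> s)"
  unfolding greatest_def Lower_def by blast

lemma kappa_set_image: "kappa_set \<kappa> A \<Longrightarrow> kappa_set \<kappa> (f ` A)"
  by (cases \<kappa>) (auto intro: ordLeq_ordLess_trans[OF card_of_image])

context kappa_frame
begin

lemma kappa_sup_lub: "A \<subseteq> carrier L \<Longrightarrow> kappa_set \<kappa> A \<Longrightarrow> is_lub L (\<Squnion>A) A"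
  using kappa_sup_exists sup_eqI by metis

lemma kappa_sup_closed: "A \<subseteq> carrier L \<Longrightarrow> kappa_set \<kappa> A \<Longrightarrow> \<Squnion>A \<in> carrier L"
  using kappa_sup_lub by (simp add: is_lub_iff)

lemma meet_glb:
  "x \<in> carrier L \<Longrightarrow> y \<in> carrier L \<Longrightarrow> greatest L (x \<sqinter> y) (Lower L {x, y})"
  unfolding meet_def using inf_of_two_exists inf_eqI by metis

lemma kappa_sup_eq_bottom_iff:
  assumes "A \<subseteq> carrier L" "kappa_set \<kappa> A"
  shows "\<Squnion>A = \<bottom> \<longleftrightarrow> (\<forall>a\<in>A. a = \<bottom>)"
proof -
  have lub: "is_lub L (\<Squnion>A) A" using assms by (rule kappa_sup_lub)
  show ?thesis
  proof
    assume "\<Squnion>A = \<bottom>"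
    then show "\<forall>a\<in>A. a = \<bottom>"
      using lub assms(1) by (auto simp: is_lub_iff intro!: le_antisym)
  next
    assume "\<forall>a\<in>A. a = \<bottom>"
    then have "\<forall>a\<in>A. a \<sqsubseteq> \<bottom>" by (metis bottom_closed le_refl)
    then have "\<Squnion>A \<sqsubseteq> \<bottom>" using lub assms(1) by (simp add: is_lub_iff)
    then show "\<Squnion>A = \<bottom>"
      using kappa_sup_closed[OF assms] by (auto intro!: le_antisym)
  qed
qed

lemma prod_partial_order: "partial_order (prod_order L L)"
  by unfold_locales (auto simp: prod_order_def intro: le_antisym le_trans)

lemma prod_top: "\<top>\<^bsub>prod_order L L\<^esub> = (\<top>, \<top>)"
  unfolding top_def[of "prod_order L L"]
proof (rule some_equality)
  show g: "greatest (prod_order L L) (\<top>, \<top>) (carrier (prod_order L L))"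
    by (auto simp: greatest_def prod_order_def)
  fix p assume "greatest (prod_order L L) p (carrier (prod_order L L))"
  then show "p = (\<top>, \<top>)"
    using g partial_order.greatest_unique[OF prod_partial_order] by blast
qed

lemma prod_meet:
  assumes "a \<in> carrier L" "b \<in> carrier L" "c \<in> carrier L" "d \<in> carrier L"
  shows "(a, b) \<sqinter>\<^bsub>prod_order L L\<^esub> (c, d) = (a \<sqinter> c, b \<sqinter> d)"
  unfolding meet_def[of "prod_order L L"]
  using assms meet_glb[of a c] meet_glb[of b d]
  by (intro partial_order.inf_eqI[OF prod_partial_order])
     (auto simp: is_glb_iff prod_order_def)

lemma prod_sup:
  assumes "A \<subseteq> carrier L \<times> carrier L" "kappa_set \<kappa> A"
  shows "\<Squnion>\<^bsub>prod_order L L\<^esub> A = (\<Squnion>(fst ` A), \<Squnion>(snd ` A))"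
proof (rule partial_order.sup_eqI[OF prod_partial_order])
  have sub: "fst ` A \<subseteq> carrier L" "snd ` A \<subseteq> carrier L" using assms(1) by auto
  have "is_lub L (\<Squnion>(fst ` A)) (fst ` A)" "is_lub L (\<Squnion>(snd ` A)) (snd ` A)"
    using sub assms(2) by (auto intro!: kappa_sup_lub kappa_set_image)
  then show "is_lub (prod_order L L) (\<Squnion>(fst ` A), \<Squnion>(snd ` A)) A"
    using assms(1) sub by (subst is_lub_iff) (auto simp: is_lub_iff prod_order_def)
qed

lemma largest_dense_congruence: "frame_congruence \<kappa> L \<DD>"
proof -
  have "equiv (carrier L) \<DD>"
    by (rule equivI) (auto simp: largest_dense_def refl_on_def sym_def trans_def)
  moreover have "\<Squnion>\<^bsub>prod_order L L\<^esub> A \<in> \<DD>" if A: "A \<subseteq> \<DD>" "kappa_set \<kappa> A" for A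
  proof -
    have sub: "A \<subseteq> carrier L \<times> carrier L" using A(1) by (auto simp: largest_dense_def)
    have sub12: "fst ` A \<subseteq> carrier L" "snd ` A \<subseteq> carrier L" using sub by auto
    have k: "kappa_set \<kappa> (fst ` A)" "kappa_set \<kappa> (snd ` A)"
      using A(2) by (auto intro: kappa_set_image)
    have *: "\<Squnion>T \<sqinter> x = \<bottom> \<longleftrightarrow> (\<forall>t\<in>T. t \<sqinter> x = \<bottom>)"
      if "T \<subseteq> carrier L" "kappa_set \<kappa> T" "x \<in> carrier L" for T x
    proof -
      have "\<Squnion>T \<sqinter> x = \<Squnion>((\<lambda>t. x \<sqinter> t) ` T)"
        using meet_kappa_sup_distrib[OF that(3,1,2)] by (simp add: meet_comm)
      moreover have "(\<lambda>t. x \<sqinter> t) ` T \<subseteq> carrier L" using that by auto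
      ultimately show ?thesis
        using kappa_sup_eq_bottom_iff[OF _ kappa_set_image[OF that(2)], of "\<lambda>t. x \<sqinter> t"]
        by (auto simp: meet_comm)
    qed
    have "\<Squnion>(fst ` A) \<sqinter> x = \<bottom> \<longleftrightarrow> \<Squnion>(snd ` A) \<sqinter> x = \<bottom>" if "x \<in> carrier L" for x
      unfolding *[OF sub12(1) k(1) that] *[OF sub12(2) k(2) that]
      using A(1) that by (fastforce simp: largest_dense_def)
    then show ?thesis
      using prod_sup[OF sub A(2)] kappa_sup_closed sub12 k by (simp add: largest_dense_def)
  qed
  moreover have "p \<sqinter>\<^bsub>prod_order L L\<^esub> q \<in> \<DD>" if "p \<in> \<DD>" "q \<in> \<DD>" for p q
  proof -
    obtain a b c d where pq: "p = (a, b)" "q = (c, d)" by fastforce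
    have car: "a \<in> carrier L" "b \<in> carrier L" "c \<in> carrier L" "d \<in> carrier L"
      and ab: "\<And>x. x \<in> carrier L \<Longrightarrow> a \<sqinter> x = \<bottom> \<longleftrightarrow> b \<sqinter> x = \<bottom>"
      and cd: "\<And>x. x \<in> carrier L \<Longrightarrow> c \<sqinter> x = \<bottom> \<longleftrightarrow> d \<sqinter> x = \<bottom>"
      using that unfolding pq by (auto simp: largest_dense_def)
    have "(a \<sqinter> c) \<sqinter> x = \<bottom> \<longleftrightarrow> (b \<sqinter> d) \<sqinter> x = \<bottom>" if x: "x \<in> carrier L" for x
    proof -
      have "(a \<sqinter> c) \<sqinter> x = a \<sqinter> (c \<sqinter> x)" using car x by (simp add: meet_assoc)
      also have "\<dots> = \<bottom> \<longleftrightarrow> b \<sqinter> (c \<sqinter> x) = \<bottom>" using ab car x by simp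
      also have "b \<sqinter> (c \<sqinter> x) = c \<sqinter> (b \<sqinter> x)"
        using car x by (metis meet_assoc meet_comm)
      also have "\<dots> = \<bottom> \<longleftrightarrow> d \<sqinter> (b \<sqinter> x) = \<bottom>" using cd car x by simp
      also have "d \<sqinter> (b \<sqinter> x) = (b \<sqinter> d) \<sqinter> x"
        using car x by (metis meet_assoc meet_comm)
      finally show ?thesis .
    qed
    then show ?thesis using car by (simp add: pq prod_meet largest_dense_def)
  qed
  moreover have "\<DD> \<subseteq> carrier (prod_order L L)"
    by (auto simp: largest_dense_def prod_order_def)
  moreover have "\<top>\<^bsub>prod_order L L\<^esub> \<in> \<DD>"
    by (simp add: prod_top largest_dense_def)
  ultimately show ?thesis
    unfolding frame_congruence_def sub_kappa_frame_def by blast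
qed

lemma bottom_meet_eq: "x \<in> carrier L \<Longrightarrow> \<bottom> \<sqinter> x = \<bottom>"
  using bottom_meet eq_is_equal by simp

lemma meet_idem: "a \<in> carrier L \<Longrightarrow> a \<sqinter> a = a"
  using meet_glb[of a a] by (auto simp: is_glb_iff intro: le_antisym)

lemma largest_dense_dense: "dense_rel L \<DD>"
  unfolding dense_rel_def largest_dense_def
  by (auto simp: bottom_meet_eq) (metis meet_idem)

lemma largest_dense_largest:
  assumes C: "frame_congruence \<kappa> L C" and dense: "dense_rel L C"
  shows "C \<subseteq> \<DD>"
proof (rule subrelI)
  have eqv: "equiv (carrier L) C"
    and meets: "\<And>p q. p \<in> C \<Longrightarrow> q \<in> C \<Longrightarrow> p \<sqinter>\<^bsub>prod_order L L\<^esub> q \<in> C"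
    using C by (auto simp: frame_congruence_def sub_kappa_frame_def)
  have *: "b \<sqinter> x = \<bottom>"
    if "(a, b) \<in> C" "x \<in> carrier L" "a \<sqinter> x = \<bottom>" for a b x
  proof -
    have "a \<in> carrier L" "b \<in> carrier L" "(x, x) \<in> C"
      using that eqv by (auto simp: equiv_def refl_on_def)
    then have "(a \<sqinter> x, b \<sqinter> x) \<in> C"
      using meets[OF that(1), of "(x, x)"] that(2) by (simp add: prod_meet)
    then show ?thesis using that(3) dense by (simp add: dense_rel_def)
  qed
  fix a b assume ab: "(a, b) \<in> C"
  then have "(b, a) \<in> C" "a \<in> carrier L" "b \<in> carrier L"
    using eqv by (auto simp: equiv_def sym_def)
  then show "(a, b) \<in> \<DD>"
    using ab * unfolding largest_dense_def by blast
qed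

end

subsection \<open>The operations of a sub-\<open>\<kappa>\<close>-frame with the induced order\<close>

context kappa_frame
begin

lemma sub_partial_order: "S \<subseteq> carrier L \<Longrightarrow> partial_order (L\<lparr>carrier := S\<rparr>)"
  by unfold_locales (auto simp: eq_is_equal dest: subsetD intro: le_antisym le_trans)

lemma sub_top:
  assumes "sub_kappa_frame \<kappa> L S"
  shows "\<top>\<^bsub>L\<lparr>carrier := S\<rparr>\<^esub> = \<top>"
  unfolding top_def[of "L\<lparr>carrier := S\<rparr>"]
proof (rule some_equality)
  have S: "S \<subseteq> carrier L" "\<top> \<in> S" using assms by (auto simp: sub_kappa_frame_def)
  then show g: "greatest (L\<lparr>carrier := S\<rparr>) \<top> (carrier (L\<lparr>carrier := S\<rparr>))"
    by (auto simp: greatest_def)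
  fix p assume "greatest (L\<lparr>carrier := S\<rparr>) p (carrier (L\<lparr>carrier := S\<rparr>))"
  then show "p = \<top>"
    using g partial_order.greatest_unique[OF sub_partial_order[OF S(1)]] by blast
qed

lemma sub_meet:
  assumes "sub_kappa_frame \<kappa> L S" "x \<in> S" "y \<in> S"
  shows "x \<sqinter>\<^bsub>L\<lparr>carrier := S\<rparr>\<^esub> y = x \<sqinter> y"
proof -
  have S: "S \<subseteq> carrier L" "x \<sqinter> y \<in> S" using assms by (auto simp: sub_kappa_frame_def)
  have xy: "x \<in> carrier L" "y \<in> carrier L" using S assms by auto
  then have "greatest L (x \<sqinter> y) (Lower L {x, y})" by (rule meet_glb)
  then show ?thesis
    using S xy assms(2,3) unfolding meet_def[of "L\<lparr>carrier := S\<rparr>"]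
    by (intro partial_order.inf_eqI[OF sub_partial_order]) (auto simp: is_glb_iff)
qed

lemma sub_sup:
  assumes "sub_kappa_frame \<kappa> L S" "A \<subseteq> S" "kappa_set \<kappa> A"
  shows "\<Squnion>\<^bsub>L\<lparr>carrier := S\<rparr>\<^esub> A = \<Squnion>A"
proof -
  have S: "S \<subseteq> carrier L" "\<Squnion>A \<in> S" using assms by (auto simp: sub_kappa_frame_def)
  have AL: "A \<subseteq> carrier L" using S assms by auto
  have lub: "is_lub L (\<Squnion>A) A" using AL assms(3) by (rule kappa_sup_lub)
  have "is_lub (L\<lparr>carrier := S\<rparr>) (\<Squnion>A) A"
    using S assms(2) lub AL by (subst is_lub_iff) (auto simp: is_lub_iff subset_iff)
  then show ?thesis
    by (rule partial_order.sup_eqI[OF sub_partial_order[OF S(1)]])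
qed

end

end

theory Submission
  imports Defs
begin

text \<open>
  If \<open>L\<close> is clear, the Boolean frame is the set of annihilators of \<open>L\<close>, ordered by inclusion:
  the annihilator of \<open>A\<close> consists of the elements disjoint from every member of \<open>A\<close>. This is the
  construction of the regular open sets from the open ones, with disjointness as its only
  datum. An element \<open>a\<close> is sent to the double annihilator of \<open>{a}\<close>. For every \<open>L\<close>, this
  map preserves meets and, by distributivity, \<open>\<kappa>\<close>-joins; its kernel is exactly \<open>\<DD>\<^bsub>L\<^esub>\<close>, so
  clearness is what makes it injective. Every annihilator is the join of the images of its own
  elements, so the image generates. Joins of annihilators are double annihilators of unions, and
  the frame law holds because annihilators are closed downwards (\<open>annihilators_distrib\<close>). The kernel
  is computed in \<open>regular_closure_eq_iff\<close>.

  Conversely, let \<open>S\<close> generate the Boolean frame \<open>B\<close> under joins and let \<open>f\<close> be an isomorphism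
  of \<open>L\<close> onto \<open>S\<close>. If \<open>f a \<sqsubseteq> f b\<close> fails, then the meet of \<open>f a\<close> with the complement of \<open>f b\<close> is nonzero, so
  some nonzero \<open>f x\<close> lies below it. Then \<open>b \<sqinter> x = \<bottom>\<close> while \<open>a \<sqinter> x \<noteq> \<bottom>\<close>, so \<open>\<DD>\<^bsub>L\<^esub>\<close> does not relate
  \<open>a\<close> and \<open>b\<close> (\<open>le_if_disjoint_generators\<close>).
\<close>

section \<open>Preliminaries\<close>

lemma kappa_set_empty: "admissible \<kappa> \<Longrightarrow> kappa_set \<kappa> ({} :: 'b set)"
proof (cases \<kappa>)
  case (Regular r)
  moreover assume "admissible \<kappa>"
  moreover have "Cfinite |{} :: 'b set|"
    using card_of_card_order_on[of "{} :: 'b set"] by (simp add: cfinite_def Field_card_of)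
  ultimately show ?thesis by (simp add: Cfinite_ordLess_Cinfinite)
qed simp

lemma unbounded_kappa_frame:
  assumes "kappa_frame (Unbounded :: 'u kappa) B"
  shows "kappa_frame \<kappa> B"
proof -
  interpret kappa_frame "Unbounded :: 'u kappa" B by (rule assms)
  show ?thesis
    by unfold_locales
      (auto intro: meet_join_distrib kappa_sup_exists meet_kappa_sup_distrib)
qed

lemma (in partial_order) sup_empty_eq_bottom:
  assumes "least L b (carrier L)"
  shows "\<Squnion>{} = b" "\<bottom> = b"
proof -
  show "\<Squnion>{} = b" using assms by (intro sup_eqI) simp
  show "\<bottom> = b" unfolding bottom_def
    using assms by (rule some_equality) (rule least_unique[OF _ assms])
qed

context kappa_frame
begin

lemma sup_empty: "\<Squnion>{} = \<bottom>"
  using sup_empty_eq_bottom[OF bottom_least] by simp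

lemma le_iff_meet: "x \<in> carrier L \<Longrightarrow> y \<in> carrier L \<Longrightarrow> x \<sqsubseteq> y \<longleftrightarrow> x \<sqinter> y = x"
  using weak_le_iff_join eq_is_equal by metis

lemma bottom_if_disjoint_self:
  "x \<in> carrier L \<Longrightarrow> y \<in> carrier L \<Longrightarrow> x \<sqinter> (x \<sqinter> y) = \<bottom> \<Longrightarrow> x \<sqinter> y = \<bottom>"
  by (metis meet_idem meet_assoc)

end

section \<open>The Boolean frame of annihilators\<close>

definition annihilator :: "('a, 'm) gorder_scheme \<Rightarrow> 'a set \<Rightarrow> 'a set" where
  "annihilator L A = {x \<in> carrier L. \<forall>a\<in>A. x \<sqinter>\<^bsub>L\<^esub> a = \<bottom>\<^bsub>L\<^esub>}"

definition annihilators :: "('a, 'm) gorder_scheme \<Rightarrow> 'a set gorder" where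
  "annihilators L = \<lparr>carrier = annihilator L ` Pow (carrier L), eq = (=), le = (\<subseteq>)\<rparr>"

definition regular_closure :: "('a, 'm) gorder_scheme \<Rightarrow> 'a \<Rightarrow> 'a set" where
  "regular_closure L a = annihilator L (annihilator L {a})"

lemma annihilator_Int:
  "annihilator L A \<inter> annihilator L C = annihilator L (A \<union> C)"
  by (auto simp: annihilator_def)

lemma annihilator_Union:
  "annihilator L (\<Union>F) = carrier L \<inter> (\<Inter>U\<in>F. annihilator L U)"
  by (auto simp: annihilator_def)

lemma annihilator_subset: "annihilator L A \<subseteq> carrier L"
  by (auto simp: annihilator_def)

lemma annihilator_antimono: "A \<subseteq> C \<Longrightarrow> annihilator L C \<subseteq> annihilator L A"
  by (auto simp: annihilator_def)

lemma annihilators_carrierI: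
  "A \<subseteq> carrier L \<Longrightarrow> annihilator L A \<in> carrier (annihilators L)"
  by (auto simp: annihilators_def)

lemma annihilators_subset: "X \<in> carrier (annihilators L) \<Longrightarrow> X \<subseteq> carrier L"
  using annihilator_subset by (fastforce simp: annihilators_def)

lemma annihilators_le [simp]: "X \<sqsubseteq>\<^bsub>annihilators L\<^esub> Y \<longleftrightarrow> X \<subseteq> Y"
  by (simp add: annihilators_def)

lemma annihilators_partial_order: "partial_order (annihilators L)"
  by unfold_locales (auto simp: annihilators_def)

lemma annihilators_Int_closed:
  assumes "X \<in> carrier (annihilators L)" "Y \<in> carrier (annihilators L)"
  shows "X \<inter> Y \<in> carrier (annihilators L)"
proof -
  obtain A C where AC: "X = annihilator L A" "A \<subseteq> carrier L" "Y = annihilator L C" "C \<subseteq> carrier L"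
    using assms by (auto simp: annihilators_def)
  show ?thesis
    unfolding AC annihilator_Int by (rule annihilators_carrierI) (use AC in blast)
qed

lemma annihilators_meet:
  assumes "X \<in> carrier (annihilators L)" "Y \<in> carrier (annihilators L)"
  shows "is_glb (annihilators L) (X \<inter> Y) {X, Y}"
    and "X \<sqinter>\<^bsub>annihilators L\<^esub> Y = X \<inter> Y"
proof -
  show *: "is_glb (annihilators L) (X \<inter> Y) {X, Y}"
    using assms annihilators_Int_closed[OF assms] by (subst is_glb_iff) auto
  then show "X \<sqinter>\<^bsub>annihilators L\<^esub> Y = X \<inter> Y"
    unfolding meet_def by (rule partial_order.inf_eqI[OF annihilators_partial_order])
qed

context kappa_frame
begin

lemma subset_annihilator_iff:
  assumes "A \<subseteq> carrier L" "C \<subseteq> carrier L"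
  shows "A \<subseteq> annihilator L C \<longleftrightarrow> C \<subseteq> annihilator L A"
proof -
  have "X \<subseteq> annihilator L Y \<longleftrightarrow> (\<forall>x\<in>X. \<forall>y\<in>Y. x \<sqinter> y = \<bottom>)"
    if "X \<subseteq> carrier L" for X Y
    using that by (auto simp: annihilator_def)
  then show ?thesis using assms meet_comm[of L] by metis
qed

lemma double_annihilator_subset:
  "A \<subseteq> carrier L \<Longrightarrow> A \<subseteq> annihilator L (annihilator L A)"
  using subset_annihilator_iff[of A "annihilator L A"] by (simp add: annihilator_subset)

lemma double_annihilator:
  assumes "X \<in> carrier (annihilators L)"
  shows "annihilator L (annihilator L X) = X"
proof -
  obtain A where A: "X = annihilator L A" "A \<subseteq> carrier L"
    using assms by (auto simp: annihilators_def)
  show ?thesis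
    unfolding A(1)
    using double_annihilator_subset[OF A(2)] annihilator_antimono
      double_annihilator_subset[OF annihilator_subset] by blast
qed

text \<open>Double annihilation is the closure operator of the Galois connection given by disjointness,
  and its closed sets are the annihilators; so a join is the closure of the union.\<close>

lemma annihilators_sup:
  assumes F: "F \<subseteq> carrier (annihilators L)"
  shows "is_lub (annihilators L) (annihilator L (annihilator L (\<Union>F))) F"
    and "\<Squnion>\<^bsub>annihilators L\<^esub> F = annihilator L (annihilator L (\<Union>F))"
proof -
  have U: "\<Union>F \<subseteq> carrier L" using F annihilators_subset by blast
  have "annihilator L (annihilator L (\<Union>F)) \<subseteq> X"
    if X: "X \<in> carrier (annihilators L)" "\<forall>Y\<in>F. Y \<subseteq> X" for X
  proof -
    have "\<Union>F \<subseteq> X" using X(2) by blast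
    then show ?thesis
      using double_annihilator[OF X(1)] annihilator_antimono by metis
  qed
  moreover have "Y \<subseteq> annihilator L (annihilator L (\<Union>F))" if "Y \<in> F" for Y
    using double_annihilator_subset[OF U] that by blast
  moreover have "annihilator L (annihilator L (\<Union>F)) \<in> carrier (annihilators L)"
    by (intro annihilators_carrierI annihilator_subset)
  ultimately show *: "is_lub (annihilators L) (annihilator L (annihilator L (\<Union>F))) F"
    by (simp add: is_lub_iff[OF F])
  then show "\<Squnion>\<^bsub>annihilators L\<^esub> F = annihilator L (annihilator L (\<Union>F))"
    by (rule partial_order.sup_eqI[OF annihilators_partial_order])
qed

lemma annihilator_meet_closed:
  assumes "A \<subseteq> carrier L" "x \<in> annihilator L A" "y \<in> carrier L"
  shows "x \<sqinter> y \<in> annihilator L A"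
proof -
  have x: "x \<in> carrier L" using assms by (simp add: annihilator_def)
  have "(x \<sqinter> y) \<sqinter> a = \<bottom>" if a: "a \<in> A" for a
  proof -
    have "(x \<sqinter> y) \<sqinter> a = (x \<sqinter> a) \<sqinter> y"
      using x assms a by (metis meet_assoc meet_comm subsetD)
    then show ?thesis
      using assms a by (simp add: annihilator_def bottom_meet_eq)
  qed
  then show ?thesis using x assms by (simp add: annihilator_def)
qed

lemma annihilators_meet_closed:
  assumes "X \<in> carrier (annihilators L)" "x \<in> X" "y \<in> carrier L"
  shows "x \<sqinter> y \<in> X"
  using assms annihilator_meet_closed by (auto simp: annihilators_def)

text \<open>The nontrivial inclusion of the frame law. For \<open>x\<close> in the left side and \<open>y\<close> disjoint from
  every \<open>X \<inter> U\<close>, the element \<open>x \<sqinter> y\<close> is disjoint from \<open>\<Union>F\<close>, hence from \<open>x\<close>; so it is zero.\<close>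

lemma annihilators_distrib:
  assumes X: "X \<in> carrier (annihilators L)" and F: "F \<subseteq> carrier (annihilators L)"
  shows "X \<inter> annihilator L (annihilator L (\<Union>F))
    = annihilator L (annihilator L (\<Union>U\<in>F. X \<inter> U))"
proof
  have XL: "X \<subseteq> carrier L" and FL: "\<Union>F \<subseteq> carrier L"
    using X F annihilators_subset by blast+
  show "X \<inter> annihilator L (annihilator L (\<Union>F))
    \<subseteq> annihilator L (annihilator L (\<Union>U\<in>F. X \<inter> U))"
  proof
    fix x assume x: "x \<in> X \<inter> annihilator L (annihilator L (\<Union>F))"
    have xL: "x \<in> carrier L" using x XL by blast
    have "x \<sqinter> y = \<bottom>" if y: "y \<in> annihilator L (\<Union>U\<in>F. X \<inter> U)" for y
    proof -
      have yL: "y \<in> carrier L" using y by (simp add: annihilator_def)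
      have "(x \<sqinter> y) \<sqinter> u = \<bottom>" if u: "u \<in> U" "U \<in> F" for u U
      proof -
        have uL: "u \<in> carrier L" using u FL by blast
        have "x \<sqinter> u \<in> X" using annihilators_meet_closed[OF X] x uL by blast
        moreover have "u \<sqinter> x \<in> U" using annihilators_meet_closed[of U] u F xL by blast
        ultimately have "y \<sqinter> (x \<sqinter> u) = \<bottom>"
          using y u meet_comm[of L] by (auto simp: annihilator_def)
        then show ?thesis using xL yL uL by (metis meet_assoc meet_comm)
      qed
      then have "x \<sqinter> y \<in> annihilator L (\<Union>F)"
        using xL yL by (auto simp: annihilator_def)
      then have "x \<sqinter> (x \<sqinter> y) = \<bottom>" using x by (auto simp: annihilator_def)
      then show ?thesis by (rule bottom_if_disjoint_self[OF xL yL])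
    qed
    then show "x \<in> annihilator L (annihilator L (\<Union>U\<in>F. X \<inter> U))"
      using xL by (simp add: annihilator_def)
  qed
  have "annihilator L (annihilator L (\<Union>U\<in>F. X \<inter> U)) \<subseteq> annihilator L (annihilator L X)"
    "annihilator L (annihilator L (\<Union>U\<in>F. X \<inter> U)) \<subseteq> annihilator L (annihilator L (\<Union>F))"
    by (intro annihilator_antimono; blast)+
  then show "annihilator L (annihilator L (\<Union>U\<in>F. X \<inter> U))
      \<subseteq> X \<inter> annihilator L (annihilator L (\<Union>F))"
    using double_annihilator[OF X] by blast
qed

lemma annihilator_bottom: "annihilator L {\<bottom>} = carrier L"
  using bottom_meet_eq by (auto simp: annihilator_def meet_comm[of L _ "\<bottom>"])

lemma annihilator_carrier: "annihilator L (carrier L) = {\<bottom>}"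
  using bottom_meet_eq meet_idem by (fastforce simp: annihilator_def)

lemma annihilators_top: "greatest (annihilators L) (carrier L) (carrier (annihilators L))"
  using annihilators_carrierI[of "{\<bottom>}" L] annihilators_subset
  by (auto simp: greatest_def annihilator_bottom)

lemma annihilators_bottom: "least (annihilators L) {\<bottom>} (carrier (annihilators L))"
proof -
  have "\<bottom> \<in> X" if "X \<in> carrier (annihilators L)" for X
    using that bottom_meet_eq by (auto simp: annihilators_def annihilator_def)
  then show ?thesis
    using annihilators_carrierI[of "carrier L" L]
    by (auto simp: least_def annihilator_carrier)
qed

lemma annihilators_top_eq: "\<top>\<^bsub>annihilators L\<^esub> = carrier L"
  unfolding top_def using annihilators_top
  by (rule some_equality)
    (rule partial_order.greatest_unique[OF annihilators_partial_order _ annihilators_top])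

lemma annihilators_bottom_eq: "\<bottom>\<^bsub>annihilators L\<^esub> = {\<bottom>}"
  by (rule partial_order.sup_empty_eq_bottom(2)[OF annihilators_partial_order annihilators_bottom])

lemma annihilators_kappa_frame: "kappa_frame (Unbounded :: 'u kappa) (annihilators L)"
proof -
  interpret A: partial_order "annihilators L" by (rule annihilators_partial_order)
  interpret A: bounded_lattice "annihilators L"
  proof unfold_locales
    fix X Y assume "X \<in> carrier (annihilators L)" "Y \<in> carrier (annihilators L)"
    then show "\<exists>s. is_lub (annihilators L) s {X, Y}" "\<exists>s. is_glb (annihilators L) s {X, Y}"
      using annihilators_sup(1)[of "{X, Y}"] annihilators_meet(1)[of X L Y] by auto
  next
    show "\<exists>b. least (annihilators L) b (carrier (annihilators L))"
      using annihilators_bottom by (rule exI)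
    show "\<exists>t. greatest (annihilators L) t (carrier (annihilators L))"
      using annihilators_top by (rule exI)
  qed
  have distrib: "X \<sqinter>\<^bsub>annihilators L\<^esub> (\<Squnion>\<^bsub>annihilators L\<^esub> F) =
      \<Squnion>\<^bsub>annihilators L\<^esub> ((\<lambda>Y. X \<sqinter>\<^bsub>annihilators L\<^esub> Y) ` F)"
    if X: "X \<in> carrier (annihilators L)" and F: "F \<subseteq> carrier (annihilators L)" for X F
  proof -
    have img: "(\<lambda>Y. X \<sqinter>\<^bsub>annihilators L\<^esub> Y) ` F = (\<lambda>Y. X \<inter> Y) ` F"
      using annihilators_meet(2)[OF X] F by (intro image_cong) auto
    have sub: "(\<lambda>Y. X \<inter> Y) ` F \<subseteq> carrier (annihilators L)"
      using annihilators_Int_closed[OF X] F by blast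
    have "annihilator L (annihilator L (\<Union>F)) \<in> carrier (annihilators L)"
      by (intro annihilators_carrierI annihilator_subset)
    then show ?thesis
      unfolding img annihilators_sup(2)[OF F] annihilators_sup(2)[OF sub]
      by (simp only: annihilators_meet(2)[OF X] annihilators_distrib[OF X F])
  qed
  show ?thesis
  proof unfold_locales
    fix X Y Z
    assume "X \<in> carrier (annihilators L)" "Y \<in> carrier (annihilators L)"
      "Z \<in> carrier (annihilators L)"
    then show "X \<sqinter>\<^bsub>annihilators L\<^esub> (Y \<squnion>\<^bsub>annihilators L\<^esub> Z) =
        X \<sqinter>\<^bsub>annihilators L\<^esub> Y \<squnion>\<^bsub>annihilators L\<^esub> X \<sqinter>\<^bsub>annihilators L\<^esub> Z"
      using distrib[of X "{Y, Z}"] by (simp add: join_def)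
  next
    fix F assume "F \<subseteq> carrier (annihilators L)"
    then show "\<exists>s. is_lub (annihilators L) s F" using annihilators_sup(1) by blast
  qed (rule distrib)
qed

lemma annihilators_boolean_frame: "boolean_frame (annihilators L)"
proof -
  interpret A: kappa_frame "Unbounded :: unit kappa" "annihilators L"
    by (rule annihilators_kappa_frame)
  show ?thesis
  proof unfold_locales
    fix X assume X: "X \<in> carrier (annihilators L)"
    let ?Y = "annihilator L X"
    have XL: "X \<subseteq> carrier L" using annihilators_subset[OF X] .
    have Y: "?Y \<in> carrier (annihilators L)" by (rule annihilators_carrierI[OF XL])
    have disj: "X \<inter> ?Y = {\<bottom>}"
    proof -
      have "x = \<bottom>" if "x \<in> X" "x \<in> ?Y" for x
        using that meet_idem[of x] by (auto simp: annihilator_def)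
      moreover have "\<bottom> \<in> X \<inter> ?Y"
        using annihilators_bottom X Y by (auto simp: least_def)
      ultimately show ?thesis by blast
    qed
    then have "X \<sqinter>\<^bsub>annihilators L\<^esub> ?Y = \<bottom>\<^bsub>annihilators L\<^esub>"
      by (simp add: annihilators_meet(2)[OF X Y] annihilators_bottom_eq)
    moreover have "annihilator L (X \<union> ?Y) = {\<bottom>}"
      using disj double_annihilator[OF X] by (simp add: annihilator_Int[symmetric] Int_commute)
    then have "X \<squnion>\<^bsub>annihilators L\<^esub> ?Y = \<top>\<^bsub>annihilators L\<^esub>"
      using annihilators_sup(2)[of "{X, ?Y}"] X Y
      by (simp add: join_def annihilator_bottom annihilators_top_eq)
    ultimately show "\<exists>Y\<in>carrier (annihilators L). X \<sqinter>\<^bsub>annihilators L\<^esub> Y = \<bottom>\<^bsub>annihilators L\<^esub>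
        \<and> X \<squnion>\<^bsub>annihilators L\<^esub> Y = \<top>\<^bsub>annihilators L\<^esub>"
      using Y by blast
  qed
qed

section \<open>The canonical map into the annihilators\<close>

lemma regular_closure_closed:
  "regular_closure L a \<in> carrier (annihilators L)"
  unfolding regular_closure_def by (intro annihilators_carrierI annihilator_subset)

lemma annihilator_regular_closure:
  "a \<in> carrier L \<Longrightarrow> annihilator L (regular_closure L a) = annihilator L {a}"
  unfolding regular_closure_def by (intro double_annihilator annihilators_carrierI) simp

lemma regular_closure_top: "regular_closure L \<top> = carrier L"
proof -
  have "annihilator L {\<top>} = {\<bottom>}"
    using top_meet by (auto simp: annihilator_def eq_is_equal meet_comm[of L _ "\<top>"])
  then show ?thesis by (simp add: regular_closure_def annihilator_bottom)
qed

text \<open>The inclusion from right to left applies disjointness twice: if \<open>z\<close> is disjoint from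
  \<open>x \<sqinter> y\<close>, then for \<open>c\<close> in both closures \<open>z \<sqinter> x\<close> is disjoint from \<open>y\<close>, hence from \<open>c\<close>, so \<open>z \<sqinter> c\<close> is
  disjoint from \<open>x\<close>, hence from \<open>c\<close>.\<close>

lemma regular_closure_meet:
  assumes x: "x \<in> carrier L" and y: "y \<in> carrier L"
  shows "regular_closure L (x \<sqinter> y) = regular_closure L x \<inter> regular_closure L y"
proof
  have "annihilator L {x} \<subseteq> annihilator L {x \<sqinter> y}"
    "annihilator L {y} \<subseteq> annihilator L {x \<sqinter> y}"
    using x y by (auto simp: annihilator_def) (metis meet_assoc meet_comm bottom_meet_eq)+
  then show "regular_closure L (x \<sqinter> y) \<subseteq> regular_closure L x \<inter> regular_closure L y"
    unfolding regular_closure_def using annihilator_antimono by blast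
  show "regular_closure L x \<inter> regular_closure L y \<subseteq> regular_closure L (x \<sqinter> y)"
  proof
    fix c assume c: "c \<in> regular_closure L x \<inter> regular_closure L y"
    have cL: "c \<in> carrier L" using c by (simp add: regular_closure_def annihilator_def)
    have cx: "c \<sqinter> z = \<bottom>" if "z \<in> carrier L" "z \<sqinter> x = \<bottom>" for z
      using c that by (auto simp: regular_closure_def annihilator_def)
    have cy: "c \<sqinter> z = \<bottom>" if "z \<in> carrier L" "z \<sqinter> y = \<bottom>" for z
      using c that by (auto simp: regular_closure_def annihilator_def)
    have "c \<sqinter> z = \<bottom>" if z: "z \<in> carrier L" "z \<sqinter> (x \<sqinter> y) = \<bottom>" for z
    proof -
      have "(z \<sqinter> x) \<sqinter> y = \<bottom>" using z x y by (simp add: meet_assoc)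
      then have "c \<sqinter> (z \<sqinter> x) = \<bottom>" using cy z x by simp
      then have "(c \<sqinter> z) \<sqinter> x = \<bottom>" using cL z x by (simp add: meet_assoc)
      then have "c \<sqinter> (c \<sqinter> z) = \<bottom>" using cx cL z by simp
      then show ?thesis using bottom_if_disjoint_self cL z by blast
    qed
    then show "c \<in> regular_closure L (x \<sqinter> y)"
      using cL by (auto simp: regular_closure_def annihilator_def)
  qed
qed

text \<open>The distributive law of \<open>L\<close> for \<open>\<kappa>\<close>-joins enters here: \<open>x \<sqinter> \<Squnion>A\<close> is the join of the \<open>x \<sqinter> a\<close>,
  which vanishes only if each of them does.\<close>

lemma annihilator_kappa_sup:
  assumes A: "A \<subseteq> carrier L" "kappa_set \<kappa> A"
  shows "annihilator L {\<Squnion>A} = annihilator L A"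
proof -
  have "x \<sqinter> \<Squnion>A = \<bottom> \<longleftrightarrow> (\<forall>a\<in>A. x \<sqinter> a = \<bottom>)" if x: "x \<in> carrier L" for x
  proof -
    have "(\<lambda>a. x \<sqinter> a) ` A \<subseteq> carrier L" using x A by auto
    then show ?thesis
      unfolding meet_kappa_sup_distrib[OF x A]
      using kappa_sup_eq_bottom_iff[OF _ kappa_set_image[OF A(2)], of "\<lambda>a. x \<sqinter> a"] by simp
  qed
  then show ?thesis by (auto simp: annihilator_def)
qed

text \<open>The closure of \<open>a\<close> has the same annihilator as \<open>a\<close>, so the union of the closures has the same
  annihilator as \<open>A\<close>. This serves twice: for \<open>\<kappa>\<close>-joins, and with an annihilator in place of \<open>A\<close> to see
  that the image of \<open>L\<close> generates.\<close>

lemma sup_regular_closure: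
  assumes A: "A \<subseteq> carrier L"
  shows "\<Squnion>\<^bsub>annihilators L\<^esub> (regular_closure L ` A) = annihilator L (annihilator L A)"
proof -
  have "annihilator L (\<Union>(regular_closure L ` A)) = carrier L \<inter> (\<Inter>a\<in>A. annihilator L {a})"
    unfolding annihilator_Union using A by (auto simp: annihilator_regular_closure subset_iff)
  also have "\<dots> = annihilator L A" by (auto simp: annihilator_def)
  finally show ?thesis
    using annihilators_sup(2)[of "regular_closure L ` A"] regular_closure_closed by auto
qed

lemma regular_closure_kappa_sup:
  assumes "A \<subseteq> carrier L" "kappa_set \<kappa> A"
  shows "regular_closure L (\<Squnion>A) = \<Squnion>\<^bsub>annihilators L\<^esub> (regular_closure L ` A)"
  by (simp add: regular_closure_def[of L "\<Squnion>A"] annihilator_kappa_sup[OF assms]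
      sup_regular_closure[OF assms(1)])

lemma regular_closure_eq_iff:
  assumes "a \<in> carrier L" "b \<in> carrier L"
  shows "regular_closure L a = regular_closure L b \<longleftrightarrow> (a, b) \<in> \<DD>"
proof -
  have "regular_closure L a = regular_closure L b \<longleftrightarrow> annihilator L {a} = annihilator L {b}"
    using annihilator_regular_closure assms by (metis regular_closure_def)
  also have "\<dots> \<longleftrightarrow> (a, b) \<in> \<DD>"
    using assms by (auto simp: annihilator_def largest_dense_def meet_comm)
  finally show ?thesis .
qed

lemma regular_closure_inj: "clear L \<Longrightarrow> inj_on (regular_closure L) (carrier L)"
  using regular_closure_eq_iff by (auto simp: inj_on_def clear_def)

lemma regular_closure_sub_kappa_frame:
  "sub_kappa_frame \<kappa> (annihilators L) (regular_closure L ` carrier L)"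
  unfolding sub_kappa_frame_def
proof (intro conjI ballI allI impI)
  show "regular_closure L ` carrier L \<subseteq> carrier (annihilators L)"
    using regular_closure_closed by blast
  show "\<top>\<^bsub>annihilators L\<^esub> \<in> regular_closure L ` carrier L"
    using regular_closure_top annihilators_top_eq top_closed by blast
  fix X Y assume "X \<in> regular_closure L ` carrier L" "Y \<in> regular_closure L ` carrier L"
  then show "X \<sqinter>\<^bsub>annihilators L\<^esub> Y \<in> regular_closure L ` carrier L"
    using annihilators_meet(2)[OF regular_closure_closed regular_closure_closed]
    by (auto simp: regular_closure_meet[symmetric])
next
  fix F assume F: "F \<subseteq> regular_closure L ` carrier L \<and> kappa_set \<kappa> F"
  \<comment> \<open>One preimage per member keeps the family of preimages a \<open>\<kappa>\<close>-set.\<close>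
  define A where "A = inv_into (carrier L) (regular_closure L) ` F"
  have A: "A \<subseteq> carrier L" "kappa_set \<kappa> A" "regular_closure L ` A = F"
    using F kappa_set_image inv_into_into[of _ "regular_closure L"]
    by (auto simp: A_def image_inv_into_cancel)
  show "\<Squnion>\<^bsub>annihilators L\<^esub> F \<in> regular_closure L ` carrier L"
    using regular_closure_kappa_sup[OF A(1,2)] kappa_sup_closed[OF A(1,2)] A(3) by blast
qed

lemma regular_closure_iso:
  assumes "clear L"
  shows "regular_closure L \<in>
    kappa_iso \<kappa> L ((annihilators L)\<lparr>carrier := regular_closure L ` carrier L\<rparr>)"
proof -
  interpret A: kappa_frame \<kappa> "annihilators L"
    by (rule unbounded_kappa_frame[OF annihilators_kappa_frame])
  note sub = regular_closure_sub_kappa_frame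
  show ?thesis
    unfolding kappa_iso_def kappa_hom_def
  proof (intro CollectI conjI allI ballI impI)
    show "bij_betw (regular_closure L) (carrier L)
        (carrier ((annihilators L)\<lparr>carrier := regular_closure L ` carrier L\<rparr>))"
      using regular_closure_inj[OF assms] by (simp add: bij_betw_def)
  next
    fix C assume C: "C \<subseteq> carrier L \<and> kappa_set \<kappa> C"
    then have "regular_closure L ` C \<subseteq> regular_closure L ` carrier L"
      "kappa_set \<kappa> (regular_closure L ` C)"
      by (auto intro: kappa_set_image)
    then show "regular_closure L (\<Squnion>C) =
        \<Squnion>\<^bsub>(annihilators L)\<lparr>carrier := regular_closure L ` carrier L\<rparr>\<^esub> (regular_closure L ` C)"
      using C by (simp add: A.sub_sup[OF sub] regular_closure_kappa_sup)
  qed (simp_all add: A.sub_top[OF sub] A.sub_meet[OF sub] annihilators_top_eq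
      regular_closure_top annihilators_meet(2) regular_closure_closed regular_closure_meet)
qed

lemma regular_closure_join_generates:
  "join_generates (annihilators L) (regular_closure L ` carrier L)"
  unfolding join_generates_def
proof
  fix X assume X: "X \<in> carrier (annihilators L)"
  have XL: "X \<subseteq> carrier L" by (rule annihilators_subset[OF X])
  have "X = \<Squnion>\<^bsub>annihilators L\<^esub> (regular_closure L ` X)"
    using sup_regular_closure[OF XL] double_annihilator[OF X] by simp
  then show "\<exists>F\<subseteq>regular_closure L ` carrier L. X = \<Squnion>\<^bsub>annihilators L\<^esub> F"
    using XL image_mono by metis
qed

end

section \<open>Join-dense subframes of Boolean frames are clear\<close>

text \<open>If \<open>x \<sqsubseteq> y\<close> failed, the meet of \<open>x\<close> with the complement of \<open>y\<close> would be nonzero, and a nonzero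
  generator below it would be disjoint from \<open>y\<close> but not from \<open>x\<close>.\<close>

lemma (in boolean_frame) le_if_disjoint_generators:
  assumes gen: "join_generates B S" and S: "S \<subseteq> carrier B"
    and x: "x \<in> carrier B" and y: "y \<in> carrier B"
    and disj: "\<And>s. s \<in> S \<Longrightarrow> y \<sqinter> s = \<bottom> \<Longrightarrow> x \<sqinter> s = \<bottom>"
  shows "x \<sqsubseteq> y"
proof -
  obtain y' where y': "y' \<in> carrier B" "y \<sqinter> y' = \<bottom>" "y \<squnion> y' = \<top>"
    using complement_exists[OF y] by blast
  obtain A where A: "A \<subseteq> S" "x \<sqinter> y' = \<Squnion>A"
    using gen x y'(1) unfolding join_generates_def by (meson meet_closed)
  have AL: "A \<subseteq> carrier B" using A(1) S by blast
  have "s = \<bottom>" if s: "s \<in> A" for s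
  proof -
    have sL: "s \<in> carrier B" using s AL by blast
    have le: "s \<sqsubseteq> x \<sqinter> y'"
      using kappa_sup_lub[OF AL] s AL A(2) by (simp add: is_lub_iff)
    have sx: "x \<sqinter> s = s" and sy': "y' \<sqinter> s = s"
      using le sL x y'(1) meet_left meet_right le_trans le_iff_meet meet_comm[of B]
      by (metis meet_closed)+
    have "y \<sqinter> s = (y \<sqinter> y') \<sqinter> s"
      using sy' y y'(1) sL by (simp add: meet_assoc)
    then have "y \<sqinter> s = \<bottom>" using y'(2) bottom_meet_eq[OF sL] by simp
    then show ?thesis using disj s A(1) sx by auto
  qed
  then have 0: "x \<sqinter> y' = \<bottom>"
    using A(2) kappa_sup_eq_bottom_iff[OF AL] by simp
  have "x = x \<sqinter> (y \<squnion> y')" using y'(3) x top_meet meet_comm[of B] by (simp add: eq_is_equal)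
  also have "\<dots> = (x \<sqinter> y) \<squnion> \<bottom>" using meet_join_distrib[OF x y y'(1)] 0 by simp
  also have "\<dots> = x \<sqinter> y"
    using bottom_join[of "x \<sqinter> y"] x y by (simp add: eq_is_equal join_comm)
  finally show ?thesis using le_iff_meet[OF x y] by simp
qed

lemma clear_if_join_generating_embedding:
  fixes \<kappa> :: "'k kappa" and L :: "('a, 'm) gorder_scheme" and B :: "('b, 'n) gorder_scheme"
  assumes adm: "admissible \<kappa>" and L: "kappa_frame \<kappa> L" and B: "boolean_frame B"
    and sub: "sub_kappa_frame \<kappa> B S" and iso: "f \<in> kappa_iso \<kappa> L (B\<lparr>carrier := S\<rparr>)"
    and gen: "join_generates B S"
  shows "clear L"
proof -
  interpret L: kappa_frame \<kappa> L by (rule L)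
  interpret B: boolean_frame B by (rule B)
  interpret Bk: kappa_frame \<kappa> B by (rule unbounded_kappa_frame) (rule B.kappa_frame_axioms)
  have S: "S \<subseteq> carrier B" using sub by (simp add: sub_kappa_frame_def)
  have f: "inj_on f (carrier L)" "f ` carrier L = S"
    using iso by (auto simp: kappa_iso_def bij_betw_def)
  have f_meet: "f (x \<sqinter>\<^bsub>L\<^esub> y) = f x \<sqinter>\<^bsub>B\<^esub> f y" if "x \<in> carrier L" "y \<in> carrier L" for x y
    using iso that f(2) Bk.sub_meet[OF sub, of "f x" "f y"]
    by (auto simp: kappa_iso_def kappa_hom_def)
  \<comment> \<open>Homomorphisms preserve \<open>\<bottom>\<close> as the empty join; \<open>\<kappa>\<close> is infinite, so \<open>{}\<close> is a \<open>\<kappa>\<close>-set.\<close>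
  have f_bottom: "f \<bottom>\<^bsub>L\<^esub> = \<bottom>\<^bsub>B\<^esub>"
  proof -
    have "f (\<Squnion>\<^bsub>L\<^esub> {}) = \<Squnion>\<^bsub>B\<lparr>carrier := S\<rparr>\<^esub> {}"
      using iso kappa_set_empty[OF adm, where ?'b = 'a]
      by (fastforce simp: kappa_iso_def kappa_hom_def)
    then show ?thesis
      using Bk.sub_sup[OF sub, of "{}"] kappa_set_empty[OF adm]
      by (simp add: L.sup_empty Bk.sup_empty)
  qed
  have disjoint_iff: "f x \<sqinter>\<^bsub>B\<^esub> f y = \<bottom>\<^bsub>B\<^esub> \<longleftrightarrow> x \<sqinter>\<^bsub>L\<^esub> y = \<bottom>\<^bsub>L\<^esub>"
    if "x \<in> carrier L" "y \<in> carrier L" for x y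
    using f(1) f_meet[OF that] f_bottom that by (metis inj_on_eq_iff L.meet_closed L.bottom_closed)
  have le: "f a \<sqsubseteq>\<^bsub>B\<^esub> f b" if ab: "(a, b) \<in> \<DD>\<^bsub>L\<^esub>" for a b
  proof (rule B.le_if_disjoint_generators[OF gen S])
    have abL: "a \<in> carrier L" "b \<in> carrier L" using ab by (auto simp: largest_dense_def)
    show "f a \<in> carrier B" "f b \<in> carrier B" using abL f(2) S by auto
    show "f a \<sqinter>\<^bsub>B\<^esub> s = \<bottom>\<^bsub>B\<^esub>" if "s \<in> S" "f b \<sqinter>\<^bsub>B\<^esub> s = \<bottom>\<^bsub>B\<^esub>" for s
      using that ab abL disjoint_iff unfolding f(2)[symmetric] by (auto simp: largest_dense_def)
  qed
  have "\<DD>\<^bsub>L\<^esub> \<subseteq> Id_on (carrier L)"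
  proof (rule subrelI)
    fix a b assume ab: "(a, b) \<in> \<DD>\<^bsub>L\<^esub>"
    have ba: "(b, a) \<in> \<DD>\<^bsub>L\<^esub>" and abL: "a \<in> carrier L" "b \<in> carrier L"
      using ab by (auto simp: largest_dense_def)
    have "f a = f b"
      using le[OF ab] le[OF ba] abL f(2) S by (intro B.le_antisym) auto
    then have "a = b" using f(1) abL by (simp add: inj_on_eq_iff)
    then show "(a, b) \<in> Id_on (carrier L)" using abL by blast
  qed
  moreover have "Id_on (carrier L) \<subseteq> \<DD>\<^bsub>L\<^esub>"
    by (auto simp: largest_dense_def)
  ultimately show ?thesis unfolding clear_def by (rule equalityI)
qed

theorem mainTheorem1:
  fixes \<kappa> :: "'k kappa" and L :: "('a, 'm) gorder_scheme"
  assumes "admissible \<kappa>" and "kappa_frame \<kappa> L"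
  shows "(clear L \<longleftrightarrow>
            (\<exists>(B :: 'a set gorder) S f. boolean_frame B \<and> sub_kappa_frame \<kappa> B S \<and>
               f \<in> kappa_iso \<kappa> L (B\<lparr>carrier := S\<rparr>) \<and> join_generates B S))
       \<and> (\<forall>(B :: ('b, 'n) gorder_scheme) S f. boolean_frame B \<and> sub_kappa_frame \<kappa> B S \<and>
               f \<in> kappa_iso \<kappa> L (B\<lparr>carrier := S\<rparr>) \<and> join_generates B S \<longrightarrow> clear L)"
proof -
  interpret kappa_frame \<kappa> L by (rule assms(2))
  have "\<exists>(B :: 'a set gorder) S f. boolean_frame B \<and> sub_kappa_frame \<kappa> B S \<and>
      f \<in> kappa_iso \<kappa> L (B\<lparr>carrier := S\<rparr>) \<and> join_generates B S" if "clear L"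
    using annihilators_boolean_frame regular_closure_sub_kappa_frame
      regular_closure_iso[OF that] regular_closure_join_generates by blast
  moreover have "clear L"
    if "boolean_frame B \<and> sub_kappa_frame \<kappa> B S \<and>
      f \<in> kappa_iso \<kappa> L (B\<lparr>carrier := S\<rparr>) \<and> join_generates B S"
    for B :: "'a set gorder" and S f
    using clear_if_join_generating_embedding[OF assms] that by blast
  moreover have "clear L"
    if "boolean_frame B \<and> sub_kappa_frame \<kappa> B S \<and>
      f \<in> kappa_iso \<kappa> L (B\<lparr>carrier := S\<rparr>) \<and> join_generates B S"
    for B :: "('b, 'n) gorder_scheme" and S f
    using clear_if_join_generating_embedding[OF assms] that by blast
  ultimately show ?thesis by blast
qed

end
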